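(* Let $X$ be a Tychonoff space and let $\mathscr{P}$ be an ideal of closed sets in $X$ with $|X_\mathscr{P}|\geq 3$. Then $gr(G(C_\mathscr{P}(X)))=gr(AG(C_\mathscr{P}(X)))$.
   Context: $C(X)$ is the ring of all real valued continuous functions on the Tychonoff (completely regular Hausdorff) space $X$; $Z(f)=\{x\in X: f(x)=0\}$. An ideal of closed sets in $X$ is a nonempty family $\mathscr{P}$ of closed subsets of $X$ such that $A,B\in\mathscr{P}$ implies $A\cup B\in\mathscr{P}$, and $A\in\mathscr{P}$, $C\subset A$ with $C$ closed in $X$ implies $C\in\mathscr{P}$. $C_\mathscr{P}(X)=\{f\in C(X): cl_X(X\setminus Z(f))\in\mathscr{P}\}$, a commutative ring (possibly without identity). $X_\mathscr{P}$ is the set of all $x\in X$ having an open neighborhood $V$ with $cl_XV\in\mathscr{P}$. For a commutative ring $R$, $Z(R)^*$ is the set of nonzero zero divisors, i.e. nonzero $a\in R$ with $ab=0$ for some nonzero $b\in R$, and $ann(a)=\{r\in R: ra=0\}$. The annihilator graph $AG(R)$ is the simple graph with vertex set $Z(R)^*$ in which distinct $a,b$ are adjacent iff $ann(a)\cup ann(b)\neq ann(ab)$. On $C_\mathscr{P}(X)$ define the equivalence relation $f\sim g$ iff $int_XZ(f)\cap X_\mathscr{P}=int_XZ(g)\cap X_\mathscr{P}$. Fix a set $S\subset C_\mathscr{P}(X)$ containing exactly one element of each equivalence class, and put $V(C_\mathscr{P}(X))=\{f\in S\setminus\{0\}: int_XZ(f)\cap X_\mathscr{P}\neq\emptyset\}$,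 which is a subset of $Z(C_\mathscr{P}(X))^*$. $G(C_\mathscr{P}(X))$ is the induced subgraph of $AG(C_\mathscr{P}(X))$ with vertex set $V(C_\mathscr{P}(X))$. The girth $gr(H)$ of a graph $H$ is the length of its smallest cycle. *)

theory Defs
  imports "HOL-Analysis.Analysis" "HOL-Algebra.Ring" "HOL-Library.Extended_Nat"
    "Graph_Theory.Graph_Theory"
begin

text \<open>
  Elements of $C(X)$ are represented by functions that are \<^const>\<open>extensional\<close> on the carrier
  of the space, so that HOL equality is equality of functions on $X$.
\<close>

definition cont_ring :: "'a topology \<Rightarrow> ('a \<Rightarrow> real) ring" where
  "cont_ring X = \<lparr>
     carrier = {f. continuous_map X euclideanreal f} \<inter> extensional (topspace X),
     mult = (\<lambda>f g. \<lambda>x\<in>topspace X. f x * g x),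
     one = (\<lambda>x\<in>topspace X. 1),
     zero = (\<lambda>x\<in>topspace X. 0),
     add = (\<lambda>f g. \<lambda>x\<in>topspace X. f x + g x)\<rparr>"

definition zero_set :: "'a topology \<Rightarrow> ('a \<Rightarrow> real) \<Rightarrow> 'a set" where
  "zero_set X f = {x \<in> topspace X. f x = 0}"

definition ideal_of_closed_sets :: "'a topology \<Rightarrow> 'a set set \<Rightarrow> bool" where
  "ideal_of_closed_sets X P \<longleftrightarrow>
     P \<noteq> {} \<and> (\<forall>A\<in>P. closedin X A) \<and>
     (\<forall>A\<in>P. \<forall>B\<in>P. A \<union> B \<in> P) \<and>
     (\<forall>A\<in>P. \<forall>C. C \<subseteq> A \<and> closedin X C \<longrightarrow> C \<in> P)"

text \<open>
  Since $C_P(X)$ need not have an identity, the field \<^const>\<open>one\<close>, inherited from $C(X)$, is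
  not required to lie in the carrier; nothing below refers to it.
\<close>

definition CP :: "'a topology \<Rightarrow> 'a set set \<Rightarrow> ('a \<Rightarrow> real) ring" where
  "CP X P = (cont_ring X)
     \<lparr>carrier := {f \<in> carrier (cont_ring X). X closure_of (topspace X - zero_set X f) \<in> P}\<rparr>"

definition XP :: "'a topology \<Rightarrow> 'a set set \<Rightarrow> 'a set" where
  "XP X P = {x \<in> topspace X. \<exists>V. openin X V \<and> x \<in> V \<and> X closure_of V \<in> P}"

definition nonzero_zero_divisors :: "('r, 'm) ring_scheme \<Rightarrow> 'r set" where
  "nonzero_zero_divisors R =
     {a \<in> carrier R. a \<noteq> \<zero>\<^bsub>R\<^esub> \<and> (\<exists>b\<in>carrier R. b \<noteq> \<zero>\<^bsub>R\<^esub> \<and> a \<otimes>\<^bsub>R\<^esub> b = \<zero>\<^bsub>R\<^esub>)}"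

definition ann :: "('r, 'm) ring_scheme \<Rightarrow> 'r \<Rightarrow> 'r set" where
  "ann R a = {r \<in> carrier R. r \<otimes>\<^bsub>R\<^esub> a = \<zero>\<^bsub>R\<^esub>}"

text \<open>
  As usual in \<^theory>\<open>Graph_Theory.Digraph\<close>, a simple graph is a symmetric loop-free digraph
  without parallel arcs, each edge being represented by its two orientations. The relation below
  is symmetric for commutative rings.
\<close>

definition annihilator_graph :: "('r, 'm) ring_scheme \<Rightarrow> ('r, 'r \<times> 'r) pre_digraph" where
  "annihilator_graph R = with_proj \<lparr>
     pverts = nonzero_zero_divisors R,
     parcs = {(a, b). a \<in> nonzero_zero_divisors R \<and> b \<in> nonzero_zero_divisors R \<and>
                a \<noteq> b \<and> ann R a \<union> ann R b \<noteq> ann R (a \<otimes>\<^bsub>R\<^esub> b)}\<rparr>"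

text \<open>
  An edge and its reversal form a directed cycle of length 2, which is not a cycle of the
  undirected graph; hence the bound on the length. The girth of an acyclic graph is \<open>\<infinity>\<close>,
  the infimum of the empty set.
\<close>

definition girth :: "('v, 'e) pre_digraph \<Rightarrow> enat" where
  "girth G = (INF p\<in>{p. pre_digraph.cycle G p \<and> 3 \<le> length p}. enat (length p))"

definition CP_equiv :: "'a topology \<Rightarrow> 'a set set \<Rightarrow> (('a \<Rightarrow> real) \<times> ('a \<Rightarrow> real)) set" where
  "CP_equiv X P = {(f, g). f \<in> carrier (CP X P) \<and> g \<in> carrier (CP X P) \<and>
     X interior_of zero_set X f \<inter> XP X P = X interior_of zero_set X g \<inter> XP X P}"

definition class_representatives :: "'a topology \<Rightarrow> 'a set set \<Rightarrow> ('a \<Rightarrow> real) set \<Rightarrow> bool" where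
  "class_representatives X P S \<longleftrightarrow>
     S \<subseteq> carrier (CP X P) \<and> (\<forall>E \<in> carrier (CP X P) // CP_equiv X P. \<exists>!f. f \<in> S \<inter> E)"

definition VCP :: "'a topology \<Rightarrow> 'a set set \<Rightarrow> ('a \<Rightarrow> real) set \<Rightarrow> ('a \<Rightarrow> real) set" where
  "VCP X P S = {f \<in> S - {\<zero>\<^bsub>CP X P\<^esub>}. X interior_of zero_set X f \<inter> XP X P \<noteq> {}}"

definition GCP ::
  "'a topology \<Rightarrow> 'a set set \<Rightarrow> ('a \<Rightarrow> real) set \<Rightarrow> ('a \<Rightarrow> real, ('a \<Rightarrow> real) \<times> ('a \<Rightarrow> real)) pre_digraph"
  where "GCP X P S = annihilator_graph (CP X P) \<restriction> VCP X P S"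

end

theory Submission
  imports Defs
begin

text \<open>
  Both girths are equal to 3, the least length a cycle of a simple graph can have, so it is enough
  to exhibit a triangle of the annihilator graph whose vertices belong to \<^term>\<open>VCP X P S\<close>.

  Two nonzero functions \<open>f\<close> and \<open>g\<close> with disjoint cozero sets are adjacent: \<open>f g = 0\<close> is annihilated
  by everything, whereas \<open>f + g\<close> annihilates neither \<open>f\<close> nor \<open>g\<close> (lemma \<open>disjoint_cozero_adjacent\<close>).
  Given three points of \<^term>\<open>XP X P\<close>, separate them by disjoint open sets; complete regularity
  puts into each of these a nonempty cozero set of a member of \<^term>\<open>CP X P\<close>
  (lemma \<open>CP_bump\<close>). This gives a triangle in the annihilator graph.

  It remains to replace the three functions by the representatives of their classes. Members of
  \<^term>\<open>CP X P\<close> vanish off \<^term>\<open>XP X P\<close>, so the trace of the interior of the zero set on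
  \<^term>\<open>XP X P\<close> determines the closure of the cozero set within \<^term>\<open>XP X P\<close>; in particular
  equivalent functions have cozero sets contained in each other's closures
  (lemma \<open>CP_equiv_cozero_subset_closure\<close>). Open sets that lie in the closures of two disjoint open
  sets are disjoint, so the representatives again have disjoint nonempty cozero sets
  (lemma \<open>representatives_with_disjoint_cozero_sets\<close>).
  The cozero set of one of them lies in the interior of the zero set of another, which is why they
  belong to \<^term>\<open>VCP X P S\<close>.
\<close>

section \<open>Girth of graphs with a triangle\<close>

lemma girth_eq_3:
  assumes "pre_digraph.cycle G p" "length p = 3"
  shows "girth G = 3"
  unfolding girth_def
proof (rule antisym)
  have "p \<in> {p. pre_digraph.cycle G p \<and> 3 \<le> length p}"
    using assms by simp
  then have "(INF p\<in>{p. pre_digraph.cycle G p \<and> 3 \<le> length p}. enat (length p)) \<le> enat (length p)"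
    by (rule INF_lower)
  then show "(INF p\<in>{p. pre_digraph.cycle G p \<and> 3 \<le> length p}. enat (length p)) \<le> 3"
    using assms by (simp add: numeral_eq_enat)
  show "3 \<le> (INF p\<in>{p. pre_digraph.cycle G p \<and> 3 \<le> length p}. enat (length p))"
    by (rule INF_greatest) (simp add: numeral_eq_enat)
qed

lemma girth_triangle:
  assumes "tail G = fst" "head G = snd"
    and "{a, b, c} \<subseteq> verts G" "distinct [a, b, c]"
    and "{(a, b), (b, c), (c, a)} \<subseteq> arcs G"
  shows "girth G = 3"
proof (rule girth_eq_3)
  show "pre_digraph.cycle G [(a, b), (b, c), (c, a)]"
    unfolding pre_digraph.cycle_def pre_digraph.awalk_def
    using assms by (intro exI[of _ a]) (auto simp: pre_digraph.cas.simps pre_digraph.awalk_verts.simps)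
qed simp

section \<open>Cozero sets\<close>

definition cozero_set :: "'a topology \<Rightarrow> ('a \<Rightarrow> real) \<Rightarrow> 'a set" where
  "cozero_set X f = {x \<in> topspace X. f x \<noteq> 0}"

lemma topspace_diff_zero_set: "topspace X - zero_set X f = cozero_set X f"
  by (auto simp: zero_set_def cozero_set_def)

lemma interior_zero_set: "X interior_of zero_set X f = topspace X - X closure_of cozero_set X f"
  by (simp add: interior_of_closure_of topspace_diff_zero_set)

lemma carrier_CP:
  "carrier (CP X P) = {f. continuous_map X euclideanreal f \<and> f \<in> extensional (topspace X) \<and>
     X closure_of cozero_set X f \<in> P}"
  by (auto simp: CP_def cont_ring_def topspace_diff_zero_set)

lemma CP_simps [simp]:
  "\<zero>\<^bsub>CP X P\<^esub> = (\<lambda>x\<in>topspace X. 0)"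
  "f \<otimes>\<^bsub>CP X P\<^esub> g = (\<lambda>x\<in>topspace X. f x * g x)"
  "f \<oplus>\<^bsub>CP X P\<^esub> g = (\<lambda>x\<in>topspace X. f x + g x)"
  by (auto simp: CP_def cont_ring_def)

lemma openin_cozero_set:
  assumes "continuous_map X euclideanreal f"
  shows "openin X (cozero_set X f)"
  using openin_continuous_map_preimage[OF assms, of "- {0}"] by (simp add: cozero_set_def open_Compl)

lemma cozero_set_subset_XP:
  assumes "f \<in> carrier (CP X P)"
  shows "cozero_set X f \<subseteq> XP X P"
  using assms openin_cozero_set[of X f] by (auto simp: carrier_CP XP_def cozero_set_def)

lemma cozero_set_eq_empty_iff:
  assumes "f \<in> extensional (topspace X)"
  shows "cozero_set X f = {} \<longleftrightarrow> f = (\<lambda>x\<in>topspace X. 0)"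
proof
  assume "cozero_set X f = {}"
  then show "f = (\<lambda>x\<in>topspace X. 0)"
    using assms by (intro extensionalityI[of _ "topspace X"]) (auto simp: cozero_set_def)
qed (auto simp: cozero_set_def)

lemma mult_eq_zero_iff_disjnt:
  "f \<otimes>\<^bsub>CP X P\<^esub> g = \<zero>\<^bsub>CP X P\<^esub> \<longleftrightarrow> disjnt (cozero_set X f) (cozero_set X g)"
proof -
  have "(\<lambda>x\<in>topspace X. f x * g x) = (\<lambda>x\<in>topspace X. 0) \<longleftrightarrow>
      (\<forall>x\<in>topspace X. f x * g x = 0)"
    (is "?l = ?r \<longleftrightarrow> _")
  proof
    assume eq: "?l = ?r"
    show "\<forall>x\<in>topspace X. f x * g x = 0"
    proof
      fix x assume "x \<in> topspace X"
      then show "f x * g x = 0"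
        using fun_cong[OF eq, of x] by simp
    qed
  next
    assume "\<forall>x\<in>topspace X. f x * g x = 0"
    then show "?l = ?r"
      by (intro restrict_ext) blast
  qed
  then show ?thesis
    unfolding CP_simps by (auto simp: cozero_set_def disjnt_iff)
qed

lemma closure_mem_ideal:
  assumes "ideal_of_closed_sets X P" "A \<in> P" "X closure_of B \<subseteq> A"
  shows "X closure_of B \<in> P"
  using assms closedin_closure_of[of X B] unfolding ideal_of_closed_sets_def by meson

lemma CP_add_closed:
  assumes "ideal_of_closed_sets X P" "f \<in> carrier (CP X P)" "g \<in> carrier (CP X P)"
  shows "f \<oplus>\<^bsub>CP X P\<^esub> g \<in> carrier (CP X P)"
proof -
  let ?h = "\<lambda>x\<in>topspace X. f x + g x"
  have "continuous_map X euclideanreal (\<lambda>x. f x + g x)"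
    using assms by (auto simp: carrier_CP intro: continuous_map_add)
  then have cont: "continuous_map X euclideanreal ?h"
    by (rule continuous_map_eq) simp
  have "cozero_set X ?h \<subseteq> cozero_set X f \<union> cozero_set X g"
    by (auto simp: cozero_set_def)
  then have "X closure_of cozero_set X ?h \<subseteq> X closure_of cozero_set X f \<union> X closure_of cozero_set X g"
    by (metis closure_of_mono closure_of_Un)
  moreover have "X closure_of cozero_set X f \<union> X closure_of cozero_set X g \<in> P"
    using assms by (auto simp: carrier_CP ideal_of_closed_sets_def)
  ultimately have "X closure_of cozero_set X ?h \<in> P"
    using closure_mem_ideal[OF assms(1)] by blast
  with cont show ?thesis
    by (simp add: carrier_CP)
qed

section \<open>Adjacency of functions with disjoint cozero sets\<close>

lemma disjoint_cozero_zero_divisor: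
  assumes "f \<in> carrier (CP X P)" "g \<in> carrier (CP X P)"
    and "cozero_set X f \<noteq> {}" "cozero_set X g \<noteq> {}"
    and "disjnt (cozero_set X f) (cozero_set X g)"
  shows "f \<in> nonzero_zero_divisors (CP X P)"
  using assms mult_eq_zero_iff_disjnt[of X P f g] cozero_set_eq_empty_iff[of _ X]
  by (auto simp: nonzero_zero_divisors_def carrier_CP)

text \<open>
  As \<open>f g = 0\<close>, the annihilator of the product is the whole ring, while on the cozero set of either
  function \<open>f + g\<close> agrees with that function and hence annihilates neither.
\<close>

lemma disjoint_cozero_adjacent:
  assumes "ideal_of_closed_sets X P"
    and f: "f \<in> carrier (CP X P)" "cozero_set X f \<noteq> {}"
    and g: "g \<in> carrier (CP X P)" "cozero_set X g \<noteq> {}"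
    and disj: "disjnt (cozero_set X f) (cozero_set X g)"
  shows "(f, g) \<in> arcs (annihilator_graph (CP X P))"
proof -
  let ?R = "CP X P"
  let ?h = "f \<oplus>\<^bsub>?R\<^esub> g"
  have h: "?h \<in> carrier ?R"
    using assms by (intro CP_add_closed)
  have "f \<otimes>\<^bsub>?R\<^esub> g = \<zero>\<^bsub>?R\<^esub>"
    using disj by (simp only: mult_eq_zero_iff_disjnt)
  then have "?h \<in> ann ?R (f \<otimes>\<^bsub>?R\<^esub> g)"
    using h by (auto simp: ann_def restrict_def fun_eq_iff)
  moreover have "cozero_set X f \<union> cozero_set X g \<subseteq> cozero_set X ?h"
    using disj by (auto simp: disjnt_iff cozero_set_def)
  then have "\<not> disjnt (cozero_set X ?h) (cozero_set X f)"
    and "\<not> disjnt (cozero_set X ?h) (cozero_set X g)"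
    using f(2) g(2) unfolding disjnt_def by blast+
  then have "?h \<notin> ann ?R f \<union> ann ?R g"
    unfolding ann_def by (simp add: mult_eq_zero_iff_disjnt del: CP_simps)
  moreover have "f \<noteq> g"
    using f(2) disj by auto
  moreover have "f \<in> nonzero_zero_divisors ?R" "g \<in> nonzero_zero_divisors ?R"
    using disjoint_cozero_zero_divisor f g disj disjnt_sym by metis+
  ultimately show ?thesis
    by (auto simp: annihilator_graph_def simp del: CP_simps)
qed

section \<open>Functions with small cozero sets\<close>

text \<open>
  The function \<open>1 - h\<close>, where \<open>h\<close> separates \<open>x\<close> from the complement of \<open>U \<inter> V\<close> and the closure of
  the neighborhood \<open>V\<close> of \<open>x\<close> belongs to the ideal: its cozero set lies in \<open>V\<close>, so its support
  belongs to the ideal as well.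
\<close>

lemma CP_bump:
  assumes "completely_regular_space X" "ideal_of_closed_sets X P"
    and "x \<in> XP X P" "openin X U" "x \<in> U"
  obtains f where "f \<in> carrier (CP X P)" "x \<in> cozero_set X f" "cozero_set X f \<subseteq> U"
proof -
  obtain V where V: "openin X V" "x \<in> V" "X closure_of V \<in> P" and x: "x \<in> topspace X"
    using assms(3) by (auto simp: XP_def)
  have "openin X (U \<inter> V)" "x \<in> U \<inter> V"
    using assms V by auto
  then obtain h where h: "continuous_map X euclideanreal h" "h x = 0"
    and h1: "h ` (topspace X - (U \<inter> V)) \<subseteq> {1}"
    using assms(1) unfolding completely_regular_space_alt' by meson
  define f where "f = (\<lambda>y\<in>topspace X. 1 - h y)"
  have "continuous_map X euclideanreal (\<lambda>y. 1 - h y)"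
    using h(1) by (intro continuous_intros) auto
  then have cont: "continuous_map X euclideanreal f"
    by (rule continuous_map_eq) (simp add: f_def)
  have sub: "cozero_set X f \<subseteq> U \<inter> V"
    using h1 by (auto simp: cozero_set_def f_def image_subset_iff)
  then have "X closure_of cozero_set X f \<subseteq> X closure_of V"
    by (intro closure_of_mono) auto
  then have "X closure_of cozero_set X f \<in> P"
    using closure_mem_ideal assms(2) V(3) by blast
  then have "f \<in> carrier (CP X P)"
    using cont by (simp add: carrier_CP f_def)
  moreover have "x \<in> cozero_set X f"
    using x h(2) by (simp add: cozero_set_def f_def)
  ultimately show thesis
    using that sub by blast
qed

lemma Hausdorff_space_separate_finite:
  assumes "Hausdorff_space X" "finite F" "F \<subseteq> topspace X"
  obtains U where "\<And>x. x \<in> F \<Longrightarrow> openin X (U x) \<and> x \<in> U x"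
    and "pairwise (\<lambda>x y. disjnt (U x) (U y)) F"
proof -
  define Q where "Q x y A B \<longleftrightarrow> openin X A \<and> openin X B \<and> x \<in> A \<and> y \<in> B \<and> disjnt A B" for x y A B
  have ex: "\<exists>A B. Q x y A B" if "x \<in> F" "y \<in> F" "x \<noteq> y" for x y
  proof -
    have "x \<in> topspace X \<and> y \<in> topspace X \<and> x \<noteq> y"
      using assms(3) that by blast
    then show ?thesis
      using assms(1) unfolding Hausdorff_space_def Q_def by simp
  qed
  define A where "A x y = (SOME A. \<exists>B. Q x y A B)" for x y
  define B where "B x y = (SOME B. Q x y (A x y) B)" for x y
  have "Q x y (A x y) (B x y)" if "x \<in> F" "y \<in> F" "x \<noteq> y" for x y
    unfolding B_def using someI_ex[OF ex[OF that]] unfolding A_def by (rule someI_ex)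
  then have AB: "openin X (A x y) \<and> openin X (B x y) \<and> x \<in> A x y \<and> y \<in> B x y \<and> disjnt (A x y) (B x y)"
    if "x \<in> F" "y \<in> F" "x \<noteq> y" for x y
    using that by (simp add: Q_def)
  \<comment> \<open>The neighborhoods chosen for \<open>(x, y)\<close> and for \<open>(y, x)\<close> are unrelated, hence both are cut down.\<close>
  define U where "U x = (\<Inter>y\<in>F - {x}. A x y \<inter> B y x) \<inter> topspace X" for x
  have "openin X (U x) \<and> x \<in> U x" if "x \<in> F" for x
    unfolding U_def
  proof
    show "openin X ((\<Inter>y\<in>F - {x}. A x y \<inter> B y x) \<inter> topspace X)"
      using that AB assms(2) by (intro openin_INT openin_Int) auto
    show "x \<in> (\<Inter>y\<in>F - {x}. A x y \<inter> B y x) \<inter> topspace X"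
      using that AB assms(3) by auto
  qed
  moreover have "pairwise (\<lambda>x y. disjnt (U x) (U y)) F"
  proof (intro pairwiseI)
    fix x y assume "x \<in> F" "y \<in> F" "x \<noteq> y"
    moreover from this have "U x \<subseteq> A x y" "U y \<subseteq> B x y"
      by (auto simp: U_def)
    ultimately show "disjnt (U x) (U y)"
      using AB disjnt_subset1 disjnt_subset2 by meson
  qed
  ultimately show thesis
    using that by blast
qed

section \<open>Passing to representatives\<close>

text \<open>
  The interior of the zero set is the complement of the closure of the cozero set. A point where
  \<open>f\<close> does not vanish lies in \<^term>\<open>XP X P\<close>, where this interior is the same for \<open>f\<close> and \<open>g\<close>.
\<close>

lemma CP_equiv_cozero_subset_closure:
  assumes "(f, g) \<in> CP_equiv X P"
  shows "cozero_set X f \<subseteq> X closure_of cozero_set X g"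
proof
  fix y assume y: "y \<in> cozero_set X f"
  have f: "f \<in> carrier (CP X P)"
    and eq: "X interior_of zero_set X f \<inter> XP X P = X interior_of zero_set X g \<inter> XP X P"
    using assms by (auto simp: CP_equiv_def)
  have "y \<in> topspace X" "y \<in> XP X P"
    using y cozero_set_subset_XP[OF f] by (auto simp: cozero_set_def)
  moreover have "y \<notin> X interior_of zero_set X f"
    using y interior_of_subset by (fastforce simp: cozero_set_def zero_set_def)
  ultimately show "y \<in> X closure_of cozero_set X g"
    using eq by (auto simp: interior_zero_set)
qed

lemma CP_equiv_sym: "(f, g) \<in> CP_equiv X P \<Longrightarrow> (g, f) \<in> CP_equiv X P"
  by (simp add: CP_equiv_def)

lemma class_representative_exists:
  assumes "class_representatives X P S" "f \<in> carrier (CP X P)"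
  obtains g where "g \<in> S" "(f, g) \<in> CP_equiv X P"
proof -
  have "CP_equiv X P `` {f} \<in> carrier (CP X P) // CP_equiv X P"
    using assms(2) by (rule quotientI)
  then obtain g where "g \<in> S \<inter> CP_equiv X P `` {f}"
    using assms(1) unfolding class_representatives_def by (metis (no_types, lifting))
  then show thesis
    using that by auto
qed

text \<open>
  An open set that misses a set also misses its closure; this is applied to \<open>A\<close> and \<open>B\<close>, and then
  to \<open>D\<close> and \<open>A\<close>.
\<close>

lemma disjnt_subsets_of_closures:
  assumes "openin X A" "disjnt A B" "openin X D"
    and "C \<subseteq> X closure_of A" "D \<subseteq> X closure_of B"
  shows "disjnt C D"
proof -
  have "A \<inter> X closure_of B = {}"
    using assms(1,2) openin_Int_closure_of_eq_empty[of X A B] by (simp add: disjnt_def)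
  then have "D \<inter> A = {}"
    using assms(5) by blast
  then have "D \<inter> X closure_of A = {}"
    using assms(3) openin_Int_closure_of_eq_empty[of X D A] by simp
  then show ?thesis
    using assms(4) by (auto simp: disjnt_iff)
qed

text \<open>
  For an arbitrary finite set of points this yields a clique with one vertex per point.
\<close>

lemma representatives_with_disjoint_cozero_sets:
  assumes X: "completely_regular_space X" "Hausdorff_space X"
    and P: "ideal_of_closed_sets X P" and S: "class_representatives X P S"
    and F: "finite F" "F \<subseteq> XP X P"
  obtains g where "\<And>x. x \<in> F \<Longrightarrow> g x \<in> S \<and> cozero_set X (g x) \<noteq> {}"
    and "pairwise (\<lambda>x y. disjnt (cozero_set X (g x)) (cozero_set X (g y))) F"
proof -
  have "F \<subseteq> topspace X"
    using F(2) by (auto simp: XP_def)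
  then obtain U where U: "\<And>x. x \<in> F \<Longrightarrow> openin X (U x) \<and> x \<in> U x"
    and disjU: "pairwise (\<lambda>x y. disjnt (U x) (U y)) F"
    using Hausdorff_space_separate_finite[OF X(2) F(1)] by blast
  have "\<forall>x\<in>F. \<exists>f. f \<in> carrier (CP X P) \<and> x \<in> cozero_set X f \<and> cozero_set X f \<subseteq> U x"
    using CP_bump[OF X(1) P] U F(2) by (metis subsetD)
  then obtain f where f: "\<And>x. x \<in> F \<Longrightarrow>
      f x \<in> carrier (CP X P) \<and> x \<in> cozero_set X (f x) \<and> cozero_set X (f x) \<subseteq> U x"
    by metis
  have "\<forall>x\<in>F. \<exists>g. g \<in> S \<and> (f x, g) \<in> CP_equiv X P"
    using class_representative_exists[OF S] f by metis
  then obtain g where g: "\<And>x. x \<in> F \<Longrightarrow> g x \<in> S \<and> (f x, g x) \<in> CP_equiv X P"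
    by metis
  have "cozero_set X (g x) \<noteq> {}" if "x \<in> F" for x
    using CP_equiv_cozero_subset_closure[of "f x" "g x"] f g that by fastforce
  moreover have "disjnt (cozero_set X (g x)) (cozero_set X (g y))"
    if xy: "x \<in> F" "y \<in> F" "x \<noteq> y" for x y
  proof (rule disjnt_subsets_of_closures)
    show "disjnt (cozero_set X (f x)) (cozero_set X (f y))"
      using disjU f xy by (meson disjnt_subset1 disjnt_subset2 pairwiseD)
    show "cozero_set X (g x) \<subseteq> X closure_of cozero_set X (f x)"
      and "cozero_set X (g y) \<subseteq> X closure_of cozero_set X (f y)"
      using g xy CP_equiv_sym CP_equiv_cozero_subset_closure by blast+
    show "openin X (cozero_set X (f x))" "openin X (cozero_set X (g y))"
      using f[of x] g[of y] xy
      by (auto intro!: openin_cozero_set simp: CP_equiv_def carrier_CP)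
  qed
  ultimately show thesis
    using g by (intro that[of g] pairwiseI) auto
qed

text \<open>
  The open cozero set of \<open>g\<close>, being disjoint from that of \<open>f\<close>, is contained in the interior of the
  zero set of \<open>f\<close>, and it lies in \<^term>\<open>XP X P\<close>.
\<close>

lemma disjoint_cozero_in_VCP:
  assumes "f \<in> S" "cozero_set X f \<noteq> {}"
    and g: "g \<in> carrier (CP X P)" "cozero_set X g \<noteq> {}"
    and disj: "disjnt (cozero_set X f) (cozero_set X g)"
  shows "f \<in> VCP X P S"
proof -
  have "cozero_set X g \<subseteq> X interior_of zero_set X f"
    using disj g(1) openin_cozero_set[of X g]
    by (intro interior_of_maximal)
      (auto simp: carrier_CP disjnt_iff cozero_set_def zero_set_def)
  then have "X interior_of zero_set X f \<inter> XP X P \<noteq> {}"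
    using cozero_set_subset_XP[OF g(1)] g(2) by blast
  moreover have "f \<noteq> \<zero>\<^bsub>CP X P\<^esub>"
    using assms(2) by (auto simp: cozero_set_def)
  ultimately show ?thesis
    using assms(1) by (simp add: VCP_def)
qed

theorem corollary4p13:
  fixes X :: "'a topology" and P :: "'a set set" and S :: "('a \<Rightarrow> real) set"
  assumes "completely_regular_space X" and "Hausdorff_space X"
    and "ideal_of_closed_sets X P"
    and "infinite (XP X P) \<or> card (XP X P) \<ge> 3"
    and "class_representatives X P S"
  shows "girth (GCP X P S) = girth (annihilator_graph (CP X P))"
proof -
  obtain F where F: "F \<subseteq> XP X P" "card F = 3"
    using assms(4) infinite_arbitrarily_large obtain_subset_with_card_n by metis
  then have "finite F"
    using card.infinite by fastforce
  obtain x y z where xyz: "F = {x, y, z}" "x \<noteq> y" "y \<noteq> z" "x \<noteq> z"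
    using F(2) unfolding card_3_iff by blast
  obtain g where g: "\<And>x. x \<in> F \<Longrightarrow> g x \<in> S \<and> cozero_set X (g x) \<noteq> {}"
    and disj: "pairwise (\<lambda>x y. disjnt (cozero_set X (g x)) (cozero_set X (g y))) F"
    using representatives_with_disjoint_cozero_sets[OF assms(1-3,5) \<open>finite F\<close> F(1)] by blast
  have carr: "g x \<in> carrier (CP X P)" if "x \<in> F" for x
    using that g assms(5) by (auto simp: class_representatives_def)
  let ?A = "annihilator_graph (CP X P)" and ?G = "GCP X P S"
  have arc: "(g u, g v) \<in> arcs ?A" and vert: "g u \<in> VCP X P S"
    if "u \<in> F" "v \<in> F" "u \<noteq> v" for u v
  proof -
    have "disjnt (cozero_set X (g u)) (cozero_set X (g v))"
      using pairwiseD[OF disj that] .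
    then show "(g u, g v) \<in> arcs ?A" "g u \<in> VCP X P S"
      using that g carr
      by (auto intro!: disjoint_cozero_adjacent[OF assms(3)] disjoint_cozero_in_VCP[where g = "g v"])
  qed
  have arcs: "{(g x, g y), (g y, g z), (g z, g x)} \<subseteq> arcs ?A"
    and VCP: "{g x, g y, g z} \<subseteq> VCP X P S"
    using arc vert xyz by auto
  have dist: "distinct [g x, g y, g z]" and verts: "{g x, g y, g z} \<subseteq> verts ?A"
    using arc[of x y] arc[of y z] arc[of x z] xyz by (auto simp: annihilator_graph_def)
  have "girth ?A = 3"
    using verts dist arcs by (intro girth_triangle) (auto simp: annihilator_graph_def)
  moreover have "girth ?G = 3"
    using VCP dist arcs
    by (intro girth_triangle[of _ "g x" "g y" "g z"]) (auto simp: GCP_def annihilator_graph_def)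
  ultimately show ?thesis
    by simp
qed

end
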